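(* Let $1\le p\le n$. Then $$\mathrm{rank}\, RLS_n(p)=\mathrm{idrank}\, RLS_n(p)=|E(RLS_n(p)\setminus\{0\})|=\sum_{r=p}^{n}\binom{n}{r}\binom{r-1}{p-1}.$$
   Context: Let $[n]=\{1,2,\ldots,n\}$ with its usual order. A partial transformation of $[n]$ is a map $\alpha$ whose domain $\mathrm{Dom}\,\alpha$ and image $\mathrm{Im}\,\alpha$ are subsets of $[n]$ (the empty map is allowed); maps are written on the right and composed left to right: $x(\alpha\beta)=(x\alpha)\beta$. $\alpha$ is isotone if $x\le y$ implies $x\alpha\le y\alpha$ for all $x,y\in\mathrm{Dom}\,\alpha$, and order-decreasing if $x\alpha\le x$ for all $x\in\mathrm{Dom}\,\alpha$. $\mathcal{LS}_n$ is the semigroup of all isotone order-decreasing partial transformations of $[n]$. $K(n,p)=\{\alpha\in\mathcal{LS}_n: |\mathrm{Im}\,\alpha|\le p\}$ is a two-sided ideal of $\mathcal{LS}_n$ (so $K(n,0)$ consists of the empty map only), and for $p\ge 1$, $RLS_n(p)=K(n,p)/K(n,p-1)$ is the Rees quotient semigroup: its nonzero elements are the $\alpha\in\mathcal{LS}_n$ with $|\mathrm{Im}\,\alpha|=p$, and the product of two nonzero elements is their composite if it has image of size $p$, and $0$ otherwise. $E(RLS_n(p)\setminus\{0\})$ is the set of nonzero idempotents of $RLS_n(p)$. For a finite semigroup $S$, $\mathrm{rank}(S)$ is the minimum cardinality of a subset $A\subseteq S$ with $\langle A\rangle=S$ (subsemigroup generated by $A$), and $\mathrm{idrank}(S)$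 is the minimum cardinality of such an $A$ consisting of idempotents.
   Formalization: For p = n the rank and idrank claims fail literally: RLS_n(n) = {id, 0} has rank 2 but the sum is 1. Rank and idrank are proved literally for p < n, and for all p ≤ n with 0 counted as belonging to every generated subsemigroup; the count of idempotents holds for all p ≤ n. *)

theory Defs
  imports Complex_Main
begin

section \<open>Generation and ranks of a semigroup given by a carrier and a multiplication\<close>

inductive_set gen :: "('a \<Rightarrow> 'a \<Rightarrow> 'a) \<Rightarrow> 'a set \<Rightarrow> 'a set"
  for mul :: "'a \<Rightarrow> 'a \<Rightarrow> 'a" and A :: "'a set" where
  incl: "a \<in> A \<Longrightarrow> a \<in> gen mul A"
| mult: "a \<in> gen mul A \<Longrightarrow> b \<in> gen mul A \<Longrightarrow> mul a b \<in> gen mul A"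

definition idempotents :: "('a \<Rightarrow> 'a \<Rightarrow> 'a) \<Rightarrow> 'a set \<Rightarrow> 'a set" where
  "idempotents mul S = {a \<in> S. mul a a = a}"

definition rank :: "('a \<Rightarrow> 'a \<Rightarrow> 'a) \<Rightarrow> 'a set \<Rightarrow> nat" where
  "rank mul S =
     (LEAST k. \<exists>A. A \<subseteq> S \<and> finite A \<and> card A = k \<and> gen mul A = S)"

definition idrank :: "('a \<Rightarrow> 'a \<Rightarrow> 'a) \<Rightarrow> 'a set \<Rightarrow> nat" where
  "idrank mul S =
     (LEAST k. \<exists>A. A \<subseteq> idempotents mul S \<and> finite A \<and> card A = k \<and> gen mul A = S)"

text \<open>Ranks of a semigroup with zero \<open>z\<close>: every generated subsemigroup is understood to
  contain \<open>z\<close>. They agree with the ranks above as soon as \<open>z\<close> is a product of the generators.\<close>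

definition rank0 :: "('a \<Rightarrow> 'a \<Rightarrow> 'a) \<Rightarrow> 'a \<Rightarrow> 'a set \<Rightarrow> nat" where
  "rank0 mul z S =
     (LEAST k. \<exists>A. A \<subseteq> S \<and> finite A \<and> card A = k \<and> insert z (gen mul A) = S)"

definition idrank0 :: "('a \<Rightarrow> 'a \<Rightarrow> 'a) \<Rightarrow> 'a \<Rightarrow> 'a set \<Rightarrow> nat" where
  "idrank0 mul z S =
     (LEAST k. \<exists>A. A \<subseteq> idempotents mul S \<and> finite A \<and> card A = k \<and>
        insert z (gen mul A) = S)"


section \<open>Rees quotients\<close>

text \<open>The class of the ideal \<open>I\<close> is the zero \<open>None\<close>; every other class is a singleton
  \<open>{a}\<close>, represented by \<open>Some a\<close>.\<close>

definition rees_carrier :: "'a set \<Rightarrow> 'a set \<Rightarrow> 'a option set" where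
  "rees_carrier S I = insert None (Some ` (S - I))"

definition rees_mult ::
    "('a \<Rightarrow> 'a \<Rightarrow> 'a) \<Rightarrow> 'a set \<Rightarrow> 'a option \<Rightarrow> 'a option \<Rightarrow> 'a option" where
  "rees_mult mul I x y =
     (case (x, y) of
        (Some a, Some b) \<Rightarrow> if mul a b \<in> I then None else Some (mul a b)
      | _ \<Rightarrow> None)"


section \<open>Isotone order-decreasing partial transformations\<close>

definition isotone :: "(nat \<rightharpoonup> nat) \<Rightarrow> bool" where
  "isotone \<alpha> \<longleftrightarrow>
     (\<forall>x\<in>dom \<alpha>. \<forall>y\<in>dom \<alpha>. x \<le> y \<longrightarrow> the (\<alpha> x) \<le> the (\<alpha> y))"

definition order_decreasing :: "(nat \<rightharpoonup> nat) \<Rightarrow> bool" where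
  "order_decreasing \<alpha> \<longleftrightarrow> (\<forall>x\<in>dom \<alpha>. the (\<alpha> x) \<le> x)"

definition LS :: "nat \<Rightarrow> (nat \<rightharpoonup> nat) set" where
  "LS n = {\<alpha>. dom \<alpha> \<subseteq> {1..n} \<and> ran \<alpha> \<subseteq> {1..n} \<and> isotone \<alpha> \<and> order_decreasing \<alpha>}"

text \<open>Maps act on the right, so \<open>comp_right \<alpha> \<beta>\<close> applies \<open>\<alpha>\<close> first, whereas
  \<open>\<circ>\<^sub>m\<close> applies its right argument first.\<close>

definition comp_right :: "(nat \<rightharpoonup> nat) \<Rightarrow> (nat \<rightharpoonup> nat) \<Rightarrow> (nat \<rightharpoonup> nat)" where
  "comp_right \<alpha> \<beta> = \<beta> \<circ>\<^sub>m \<alpha>"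

definition K :: "nat \<Rightarrow> nat \<Rightarrow> (nat \<rightharpoonup> nat) set" where
  "K n p = {\<alpha> \<in> LS n. card (ran \<alpha>) \<le> p}"

definition RLS :: "nat \<Rightarrow> nat \<Rightarrow> (nat \<rightharpoonup> nat) option set" where
  "RLS n p = rees_carrier (K n p) (K n (p - 1))"

definition RLS_mult ::
    "nat \<Rightarrow> nat \<Rightarrow> (nat \<rightharpoonup> nat) option \<Rightarrow> (nat \<rightharpoonup> nat) option \<Rightarrow> (nat \<rightharpoonup> nat) option" where
  "RLS_mult n p = rees_mult comp_right (K n (p - 1))"


section \<open>The ideals and the role of the zero\<close>

lemma LS_comp:
  assumes "\<alpha> \<in> LS n" and "\<beta> \<in> LS n"
  shows "comp_right \<alpha> \<beta> \<in> LS n"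
proof -
  have d: "x \<in> dom \<alpha>" "the (\<alpha> x) \<in> dom \<beta>"
      "the (comp_right \<alpha> \<beta> x) = the (\<beta> (the (\<alpha> x)))"
    if "x \<in> dom (comp_right \<alpha> \<beta>)" for x
    using that by (auto simp: comp_right_def map_comp_def split: option.splits)
  have "dom (comp_right \<alpha> \<beta>) \<subseteq> dom \<alpha>" using d(1) by (rule subsetI)
  moreover have "ran (comp_right \<alpha> \<beta>) \<subseteq> ran \<beta>"
    by (auto simp: comp_right_def ran_def map_comp_def split: option.splits)
  moreover have "isotone (comp_right \<alpha> \<beta>)"
    unfolding isotone_def
  proof (intro ballI impI)
    fix x y
    assume x: "x \<in> dom (comp_right \<alpha> \<beta>)" and y: "y \<in> dom (comp_right \<alpha> \<beta>)"
      and "x \<le> y"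
    then have "the (\<alpha> x) \<le> the (\<alpha> y)"
      using assms(1) d(1)[OF x] d(1)[OF y] unfolding LS_def isotone_def by blast
    then have "the (\<beta> (the (\<alpha> x))) \<le> the (\<beta> (the (\<alpha> y)))"
      using assms(2) d(2)[OF x] d(2)[OF y] unfolding LS_def isotone_def by blast
    then show "the (comp_right \<alpha> \<beta> x) \<le> the (comp_right \<alpha> \<beta> y)"
      by (simp only: d(3)[OF x] d(3)[OF y])
  qed
  moreover have "order_decreasing (comp_right \<alpha> \<beta>)"
    unfolding order_decreasing_def
  proof
    fix x
    assume x: "x \<in> dom (comp_right \<alpha> \<beta>)"
    have "the (\<beta> (the (\<alpha> x))) \<le> the (\<alpha> x)"
      using assms(2) d(2)[OF x] unfolding LS_def order_decreasing_def by blast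
    also have "\<dots> \<le> x"
      using assms(1) d(1)[OF x] unfolding LS_def order_decreasing_def by blast
    finally show "the (comp_right \<alpha> \<beta> x) \<le> x"
      by (simp only: d(3)[OF x])
  qed
  ultimately show ?thesis
    using assms unfolding LS_def by blast
qed

lemma K_ideal:
  assumes "\<alpha> \<in> K n p" and "\<beta> \<in> LS n"
  shows "comp_right \<alpha> \<beta> \<in> K n p" and "comp_right \<beta> \<alpha> \<in> K n p"
proof -
  have a: "\<alpha> \<in> LS n" and c: "card (ran \<alpha>) \<le> p"
    using assms(1) by (auto simp: K_def)
  have fin: "finite (ran \<alpha>)"
    using a by (auto simp: LS_def intro: finite_subset)
  have "ran (comp_right \<alpha> \<beta>) \<subseteq> (\<lambda>x. the (\<beta> x)) ` ran \<alpha>"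
    by (force simp: comp_right_def ran_def map_comp_def split: option.splits)
  then have "card (ran (comp_right \<alpha> \<beta>)) \<le> card (ran \<alpha>)"
    using fin by (meson card_image_le card_mono finite_imageI order_trans)
  then show "comp_right \<alpha> \<beta> \<in> K n p"
    using LS_comp[OF a assms(2)] c by (simp add: K_def)
  have "ran (comp_right \<beta> \<alpha>) \<subseteq> ran \<alpha>"
    by (auto simp: comp_right_def ran_def map_comp_def split: option.splits)
  then have "card (ran (comp_right \<beta> \<alpha>)) \<le> card (ran \<alpha>)"
    using fin by (simp add: card_mono)
  then show "comp_right \<beta> \<alpha> \<in> K n p"
    using LS_comp[OF assms(2) a] c by (simp add: K_def)
qed

text \<open>For \<open>p = n\<close> the only nonzero element of \<open>RLS n n\<close> is the identity map, and the zero is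
  not a product of nonzero elements. So \<open>RLS n n\<close> has rank 2 as a semigroup, and rank 1
  only as a semigroup with zero.\<close>

lemma RLS_top:
  assumes "1 \<le> n"
  shows "RLS n n = {None, Some (\<lambda>x. if x \<in> {1..n} then Some x else None)}"
    and "None \<notin> gen (RLS_mult n n) (RLS n n - {None})"
proof -
  define e :: "nat \<rightharpoonup> nat" where "e = (\<lambda>x. if x \<in> {1..n} then Some x else None)"
  have e_in: "e x = Some x" if "x \<in> {1..n}" for x
    using that by (simp add: e_def)
  have e_out: "e x = None" if "x \<notin> {1..n}" for x
    unfolding e_def using that by (rule if_not_P)
  have e_Some: "e x = Some y \<longleftrightarrow> x \<in> {1..n} \<and> y = x" for x y
    by (cases "x \<in> {1..n}") (use e_in e_out in force)+
  have dom_e: "dom e = {1..n}"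
    by (rule set_eqI) (metis domIff e_in e_out option.distinct(1))
  have ran_e: "ran e = {1..n}" unfolding ran_def e_Some by blast
  have "isotone e" "order_decreasing e"
    using e_in unfolding isotone_def order_decreasing_def dom_e by simp_all
  then have e_K: "e \<in> K n n - K n (n - 1)"
    using assms by (simp add: K_def LS_def dom_e ran_e)
  have uniq: "\<alpha> = e" if "\<alpha> \<in> K n n - K n (n - 1)" for \<alpha>
  proof -
    have L: "\<alpha> \<in> LS n" and c: "card (ran \<alpha>) = n"
      using that assms by (auto simp: K_def)
    have d: "dom \<alpha> \<subseteq> {1..n}" and r: "ran \<alpha> \<subseteq> {1..n}"
      and iso: "isotone \<alpha>" and dec: "order_decreasing \<alpha>"
      using L by (auto simp: LS_def)
    have r_eq: "ran \<alpha> = {1..n}"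
      using r c by (intro card_subset_eq) auto
    have im: "ran \<alpha> = (\<lambda>x. the (\<alpha> x)) ` dom \<alpha>"
      by (force simp: ran_def dom_def)
    have fd: "finite (dom \<alpha>)" using d by (rule finite_subset) simp
    have "card (dom \<alpha>) \<ge> n" using card_image_le[OF fd, of "\<lambda>x. the (\<alpha> x)"] im c by simp
    then have d_eq: "dom \<alpha> = {1..n}"
      using d card_mono[of "{1..n}" "dom \<alpha>"] by (intro card_subset_eq) auto
    have inj: "inj_on (\<lambda>x. the (\<alpha> x)) {1..n}"
      using im c d_eq by (intro eq_card_imp_inj_on) auto
    have fixes_x: "the (\<alpha> x) = x" if "x \<in> {1..n}" for x
      using that
    proof (induction x rule: less_induct)
      case (less x)
      have le: "the (\<alpha> x) \<le> x"
        using dec less.prems unfolding order_decreasing_def d_eq by blast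
      have "the (\<alpha> x) \<in> {1..n}"
        using im r_eq d_eq less.prems by blast
      moreover have False if lt: "the (\<alpha> x) < x" and y: "the (\<alpha> x) \<in> {1..n}"
        using less.IH[OF lt y] inj_onD[OF inj _ y less.prems] lt by simp
      ultimately show ?case using le le_neq_implies_less by blast
    qed
    show ?thesis
    proof
      fix x
      show "\<alpha> x = e x"
      proof (cases "x \<in> {1..n}")
        case True
        then obtain y where "\<alpha> x = Some y" using d_eq by blast
        then show ?thesis using fixes_x[OF True] e_in[OF True] by simp
      next
        case False
        then have "\<alpha> x = None" using d_eq by blast
        then show ?thesis using e_out[OF False] by simp
      qed
    qed
  qed
  have "K n n - K n (n - 1) = {e}" using e_K uniq by blast
  then have R: "RLS n n = {None, Some e}"
    by (simp add: RLS_def rees_carrier_def)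
  then show "RLS n n = {None, Some (\<lambda>x. if x \<in> {1..n} then Some x else None)}"
    unfolding e_def .
  have ee: "comp_right e e = e"
  proof
    fix x
    show "comp_right e e x = e x"
      by (cases "x \<in> {1..n}") (use e_in e_out in \<open>simp_all add: comp_right_def\<close>)
  qed
  have "x = Some e" if "x \<in> gen (RLS_mult n n) (RLS n n - {None})" for x
    using that
  proof induction
    case (incl a)
    then show ?case using R by auto
  next
    case (mult a b)
    then show ?case using e_K ee by (simp add: RLS_mult_def rees_mult_def)
  qed
  then show "None \<notin> gen (RLS_mult n n) (RLS n n - {None})" by blast
qed

end

theory Submission
  imports Defs
begin

text \<open>A nonzero element of \<open>RLS n p\<close> is idempotent iff it fixes its image pointwise. If a product
  \<open>\<alpha>\<beta>\<close> of nonzero elements is a nonzero idempotent, then \<open>\<beta>\<close> is injective on the image of \<open>\<alpha>\<close> and,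
  both factors being order-decreasing, \<open>\<alpha>\<close> fixes every point fixed by \<open>\<alpha>\<beta>\<close>; hence \<open>\<alpha> = \<alpha>\<beta>\<close>. So every
  nonzero idempotent lies in every generating set. Conversely, if \<open>\<alpha>\<close> is not idempotent, let \<open>y\<close> be
  the largest image point not fixed by \<open>\<alpha>\<close>, let \<open>m > y\<close> be the least element of its fibre, and move
  the value of that fibre from \<open>y\<close> to \<open>m\<close>: this gives an element with fewer non-fixed image points,
  from which \<open>\<alpha>\<close> is recovered by multiplying with an idempotent sending \<open>m\<close> to \<open>y\<close>. Finally, a
  nonzero idempotent is determined by its domain \<open>D\<close> and its image, which can be any \<open>p\<close>-subset of
  \<open>D\<close> containing \<open>Min D\<close>.\<close>

section \<open>Elements of fixed rank\<close>

definition LSr :: "nat \<Rightarrow> nat \<Rightarrow> (nat \<rightharpoonup> nat) set" where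
  "LSr n p = {\<alpha> \<in> LS n. card (ran \<alpha>) = p}"

definition ELS :: "nat \<Rightarrow> nat \<Rightarrow> (nat \<rightharpoonup> nat) set" where
  "ELS n p = {\<alpha> \<in> LSr n p. \<forall>y\<in>ran \<alpha>. \<alpha> y = Some y}"

text \<open>Working form of membership, stated by equations \<open>\<alpha> x = Some y\<close>
  instead of \<open>dom\<close>, \<open>ran\<close> and \<open>the\<close>. The chain 1 \<le> y
  \<le> x \<le> n yields both inclusions in \<open>{1..n}\<close> as well as order-decrease.\<close>

lemma LS_iff:
  "\<alpha> \<in> LS n \<longleftrightarrow>
     (\<forall>x y. \<alpha> x = Some y \<longrightarrow> 1 \<le> y \<and> y \<le> x \<and> x \<le> n) \<and>
     (\<forall>x x' y y'. \<alpha> x = Some y \<longrightarrow> \<alpha> x' = Some y' \<longrightarrow> x \<le> x' \<longrightarrow> y \<le> y')"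
  (is "?L \<longleftrightarrow> ?R")
proof
  assume L: ?L
  have "1 \<le> y \<and> y \<le> x \<and> x \<le> n" if "\<alpha> x = Some y" for x y
  proof -
    have "x \<in> dom \<alpha>" "y \<in> ran \<alpha>" using that by (auto simp: ran_def)
    then have "x \<in> {1..n}" "y \<in> {1..n}" "the (\<alpha> x) \<le> x"
      using L unfolding LS_def order_decreasing_def by blast+
    then show ?thesis using that by simp
  qed
  moreover have "y \<le> y'" if "\<alpha> x = Some y" "\<alpha> x' = Some y'" "x \<le> x'" for x x' y y'
  proof -
    have "x \<in> dom \<alpha>" "x' \<in> dom \<alpha>" using that by auto
    then have "the (\<alpha> x) \<le> the (\<alpha> x')"
      using L that(3) unfolding LS_def isotone_def by blast
    then show ?thesis using that by simp
  qed
  ultimately show ?R by blast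
next
  assume R: ?R
  have "x \<in> {1..n} \<and> y \<in> {1..n}" if "\<alpha> x = Some y" for x y
  proof -
    have "1 \<le> y \<and> y \<le> x \<and> x \<le> n" using R that by blast
    then show ?thesis by simp
  qed
  then have "dom \<alpha> \<subseteq> {1..n}" "ran \<alpha> \<subseteq> {1..n}"
    unfolding ran_def dom_def by blast+
  moreover have "isotone \<alpha>" "order_decreasing \<alpha>"
    using R by (auto simp: isotone_def order_decreasing_def)
  ultimately show ?L by (simp add: LS_def)
qed

lemma LS_bounds: "\<alpha> \<in> LS n \<Longrightarrow> \<alpha> x = Some y \<Longrightarrow> 1 \<le> y \<and> y \<le> x \<and> x \<le> n"
  unfolding LS_iff by blast

lemma LS_mono: "\<alpha> \<in> LS n \<Longrightarrow> \<alpha> x = Some y \<Longrightarrow> \<alpha> x' = Some y' \<Longrightarrow> x \<le> x' \<Longrightarrow> y \<le> y'"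
  unfolding LS_iff by blast

lemma finite_dom_LS: "\<alpha> \<in> LS n \<Longrightarrow> finite (dom \<alpha>)"
  by (auto simp: LS_def intro: finite_subset)

lemma finite_ran_LS: "\<alpha> \<in> LS n \<Longrightarrow> finite (ran \<alpha>)"
  by (auto simp: LS_def intro: finite_subset)

lemma finite_LSr: "finite (LSr n p)"
proof -
  have "LSr n p \<subseteq> {\<alpha>. dom \<alpha> \<subseteq> {1..n} \<and> ran \<alpha> \<subseteq> {1..n}}"
    by (auto simp: LSr_def LS_def)
  also have "\<dots> \<subseteq> (\<Union>D\<in>Pow {1..n}. {\<alpha>. dom \<alpha> = D \<and> ran \<alpha> \<subseteq> {1..n}})"
    by blast
  finally show ?thesis
    by (rule finite_subset) (intro finite_UN_I finite_set_of_finite_maps, auto intro: finite_subset)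
qed

lemma finite_ELS: "finite (ELS n p)"
  by (rule finite_subset[OF _ finite_LSr[of n p]]) (auto simp: ELS_def)

lemma comp_right_Some:
  "comp_right \<alpha> \<beta> x = Some z \<longleftrightarrow> (\<exists>y. \<alpha> x = Some y \<and> \<beta> y = Some z)"
  by (simp add: comp_right_def map_comp_Some_iff)

lemma comp_right_self_iff:
  "comp_right \<alpha> \<alpha> = \<alpha> \<longleftrightarrow> (\<forall>y\<in>ran \<alpha>. \<alpha> y = Some y)" if "\<alpha> \<in> LS n"
proof
  assume eq: "comp_right \<alpha> \<alpha> = \<alpha>"
  show "\<forall>y\<in>ran \<alpha>. \<alpha> y = Some y"
  proof
    fix y assume "y \<in> ran \<alpha>"
    then obtain x where x: "\<alpha> x = Some y" by (auto simp: ran_def)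
    then have "comp_right \<alpha> \<alpha> x = Some y" using eq by simp
    then show "\<alpha> y = Some y" using x by (auto simp: comp_right_Some)
  qed
next
  assume fix_ran: "\<forall>y\<in>ran \<alpha>. \<alpha> y = Some y"
  show "comp_right \<alpha> \<alpha> = \<alpha>"
  proof
    fix x
    show "comp_right \<alpha> \<alpha> x = \<alpha> x"
    proof (cases "\<alpha> x")
      case (Some y)
      then have "\<alpha> y = Some y" using fix_ran by (blast intro: ranI)
      with Some show ?thesis by (simp add: comp_right_def)
    qed (simp add: comp_right_def)
  qed
qed

section \<open>The Rees quotient\<close>

context
  fixes n p :: nat
  assumes p: "1 \<le> p"
begin

text \<open>Relies on 1 \<le> p: with truncated subtraction the left side is empty at p = 0, while
  \<open>LSr n 0\<close> contains the empty map.\<close>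

lemma K_diff: "K n p - K n (p - 1) = LSr n p"
  using p by (auto simp: K_def LSr_def)

lemma RLS_eq: "RLS n p = insert None (Some ` LSr n p)"
  unfolding RLS_def rees_carrier_def K_diff ..

lemma RLS_mult_None [simp]: "RLS_mult n p None b = None" "RLS_mult n p a None = None"
  by (simp_all add: RLS_mult_def rees_mult_def split: option.splits)

text \<open>As \<open>K n p\<close> is an ideal, a composite has at most p image points, so it
  avoids \<open>K n (p - 1)\<close> exactly when it has p of them.\<close>

lemma RLS_mult_Some:
  assumes "\<alpha> \<in> LSr n p" "\<beta> \<in> LSr n p"
  shows "RLS_mult n p (Some \<alpha>) (Some \<beta>) =
    (if comp_right \<alpha> \<beta> \<in> LSr n p then Some (comp_right \<alpha> \<beta>) else None)"
proof -
  have "\<alpha> \<in> K n p" "\<beta> \<in> LS n" using assms by (auto simp: K_def LSr_def)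
  then have "comp_right \<alpha> \<beta> \<in> K n p" by (rule K_ideal)
  then have "comp_right \<alpha> \<beta> \<in> K n (p - 1) \<longleftrightarrow> comp_right \<alpha> \<beta> \<notin> LSr n p"
    using p by (auto simp: K_def LSr_def)
  then show ?thesis by (simp add: RLS_mult_def rees_mult_def)
qed

lemma idempotents_RLS: "idempotents (RLS_mult n p) (RLS n p) = insert None (Some ` ELS n p)"
proof -
  have "RLS_mult n p (Some \<alpha>) (Some \<alpha>) = Some \<alpha> \<longleftrightarrow> \<alpha> \<in> ELS n p" if "\<alpha> \<in> LSr n p" for \<alpha>
    using that comp_right_self_iff[of \<alpha> n] by (auto simp: RLS_mult_Some ELS_def LSr_def)
  then have "idempotents (RLS_mult n p) (RLS n p) =
      insert None (Some ` {\<alpha> \<in> LSr n p. \<alpha> \<in> ELS n p})"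
    unfolding idempotents_def RLS_eq by auto
  then show ?thesis by (simp add: ELS_def)
qed

lemma nonzero_idempotents_RLS: "idempotents (RLS_mult n p) (RLS n p) - {None} = Some ` ELS n p"
  by (auto simp: idempotents_RLS)

lemma gen_subset_RLS:
  assumes "A \<subseteq> RLS n p"
  shows "gen (RLS_mult n p) A \<subseteq> RLS n p"
proof
  fix x assume "x \<in> gen (RLS_mult n p) A"
  then show "x \<in> RLS n p"
    by induction (use assms in \<open>auto simp: RLS_eq RLS_mult_Some\<close>)
qed

section \<open>Idempotents are irreducible\<close>

text \<open>A counting argument: \<beta> must carry the p points of \<open>ran \<alpha>\<close> to p
  points, so it can neither identify two of them nor be undefined at one.\<close>

lemma comp_right_inj:
  assumes a: "\<alpha> \<in> LSr n p" and b: "\<beta> \<in> LSr n p" and c: "comp_right \<alpha> \<beta> \<in> LSr n p"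
  shows "ran \<alpha> \<subseteq> dom \<beta>" and "inj_on \<beta> (ran \<alpha>)"
proof -
  have fin: "finite (ran \<alpha>)" using a by (auto simp: LSr_def intro: finite_ran_LS)
  \<comment> \<open>Here \<beta> is read as a total function into options, so undefinedness shows up
    as the value \<open>None\<close>. Removing \<open>None\<close> must still leave p
    values.\<close>
  have sub: "Some ` ran (comp_right \<alpha> \<beta>) \<subseteq> \<beta> ` ran \<alpha> - {None}"
    by (force simp: ran_def comp_right_Some)
  have "card (ran \<alpha>) = card (Some ` ran (comp_right \<alpha> \<beta>))"
    using a c by (simp add: LSr_def card_image)
  also have "\<dots> \<le> card (\<beta> ` ran \<alpha> - {None})"
    using sub fin by (intro card_mono) auto
  finally have le: "card (ran \<alpha>) \<le> card (\<beta> ` ran \<alpha> - {None})" .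
  have "card (\<beta> ` ran \<alpha> - {None}) \<le> card (\<beta> ` ran \<alpha>)"
    using fin by (intro card_mono) auto
  then have eq: "card (\<beta> ` ran \<alpha>) = card (ran \<alpha>)"
    using le card_image_le[OF fin, of \<beta>] by simp
  then show "inj_on \<beta> (ran \<alpha>)" by (rule eq_card_imp_inj_on[OF fin])
  have "None \<notin> \<beta> ` ran \<alpha>"
  proof
    assume "None \<in> \<beta> ` ran \<alpha>"
    then have "card (\<beta> ` ran \<alpha> - {None}) < card (\<beta> ` ran \<alpha>)"
      using fin by (intro card_Diff1_less) auto
    then show False using le eq by simp
  qed
  then show "ran \<alpha> \<subseteq> dom \<beta>" by force
qed

lemma idempotent_irreducible:
  assumes a: "\<alpha> \<in> LSr n p" and b: "\<beta> \<in> LSr n p" and c: "comp_right \<alpha> \<beta> \<in> ELS n p"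
  shows "comp_right \<alpha> \<beta> = \<alpha>"
proof
  fix x
  have c': "comp_right \<alpha> \<beta> \<in> LSr n p" using c by (simp add: ELS_def)
  show "comp_right \<alpha> \<beta> x = \<alpha> x"
  proof (cases "\<alpha> x")
    case (Some y)
    then have y: "y \<in> ran \<alpha>" by (auto simp: ran_def)
    then obtain z where z: "\<beta> y = Some z" using comp_right_inj(1)[OF a b c'] by blast
    then have xz: "comp_right \<alpha> \<beta> x = Some z" using Some by (simp add: comp_right_Some)
    then have "z \<in> ran (comp_right \<alpha> \<beta>)" by (auto simp: ran_def)
    then have "comp_right \<alpha> \<beta> z = Some z" using c by (simp add: ELS_def)
    \<comment> \<open>The fixed point z of the product passes through w. Both w and y are sent to z
      by \<beta>, so injectivity gives w = y. Order-decrease of \<alpha> and then of \<beta> gives w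
      \<le> z \<le> w, hence y = z.\<close>
    then obtain w where w: "\<alpha> z = Some w" "\<beta> w = Some z" by (auto simp: comp_right_Some)
    then have "w \<in> ran \<alpha>" by (auto simp: ran_def)
    then have "w = y"
      using comp_right_inj(2)[OF a b c'] y z w(2) by (metis inj_onD)
    moreover have "w \<le> z" "z \<le> w"
      using a b w by (auto simp: LSr_def dest: LS_bounds)
    ultimately show ?thesis using Some xz by simp
  qed (simp add: comp_right_def)
qed

text \<open>Induction on generation: a product equal to \<open>Some \<epsilon>\<close> has left
  factor \<open>Some \<epsilon>\<close> by irreducibility, and the induction hypothesis for that
  factor already places it in A.\<close>

lemma idempotent_in_generators:
  assumes A: "A \<subseteq> RLS n p" and e: "\<epsilon> \<in> ELS n p" and gen: "Some \<epsilon> \<in> gen (RLS_mult n p) A"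
  shows "Some \<epsilon> \<in> A"
proof -
  have "x = Some \<epsilon> \<longrightarrow> Some \<epsilon> \<in> A" if "x \<in> gen (RLS_mult n p) A" for x
    using that
  proof induction
    case (mult a b)
    show ?case
    proof
      assume ab: "RLS_mult n p a b = Some \<epsilon>"
      have "a \<in> RLS n p" "b \<in> RLS n p" using mult.hyps gen_subset_RLS[OF A] by blast+
      with ab obtain \<alpha> \<beta> where eqs: "a = Some \<alpha>" "b = Some \<beta>"
        and in_LSr: "\<alpha> \<in> LSr n p" "\<beta> \<in> LSr n p"
        by (auto simp: RLS_eq)
      then have "comp_right \<alpha> \<beta> = \<epsilon>"
        using ab by (auto simp: RLS_mult_Some split: if_splits)
      then have "a = Some \<epsilon>"
        using idempotent_irreducible[OF in_LSr] e eqs by simp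
      then show "Some \<epsilon> \<in> A" using mult.IH by simp
    qed
  qed auto
  then show ?thesis using gen by blast
qed

text \<open>Asking only that the nonzero idempotents be generated lets one bound serve both
  conventions about the zero.\<close>

lemma generators_ge:
  assumes "A \<subseteq> RLS n p" "finite A" "Some ` ELS n p \<subseteq> gen (RLS_mult n p) A"
  shows "card (Some ` ELS n p) \<le> card A"
proof (rule card_mono)
  show "Some ` ELS n p \<subseteq> A"
    using assms idempotent_in_generators by blast
qed fact

section \<open>Generation by idempotents\<close>

text \<open>The size of this set is the measure of the descent; on \<open>LSr n p\<close> it
  vanishes exactly at the idempotents. An image point outside the domain counts as moved, since
  \<alpha> is \<open>None\<close> there.\<close>

definition moved :: "(nat \<rightharpoonup> nat) \<Rightarrow> nat set" where
  "moved \<alpha> = {y \<in> ran \<alpha>. \<alpha> y \<noteq> Some y}"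

lemma factor_non_idempotent:
  assumes a: "\<alpha> \<in> LSr n p" and not_id: "\<alpha> \<notin> ELS n p"
  obtains \<beta> \<gamma> where "\<beta> \<in> LSr n p" "\<gamma> \<in> ELS n p" "comp_right \<beta> \<gamma> = \<alpha>"
    "card (moved \<beta>) < card (moved \<alpha>)"
proof -
  have L: "\<alpha> \<in> LS n" and cp: "card (ran \<alpha>) = p" using a by (auto simp: LSr_def)
  have finr: "finite (ran \<alpha>)" using L by (rule finite_ran_LS)
  have fin: "finite (moved \<alpha>)" using finr by (simp add: moved_def)
  have ne: "moved \<alpha> \<noteq> {}" using a not_id by (auto simp: ELS_def moved_def)
  define y where "y = Max (moved \<alpha>)"
  have y_mem: "y \<in> moved \<alpha>" using Max_in[OF fin ne] by (simp add: y_def)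
  then have y: "y \<in> ran \<alpha>" "\<alpha> y \<noteq> Some y" by (auto simp: moved_def)
  have above: "\<alpha> w = Some w" if "w \<in> ran \<alpha>" "y < w" for w
    using that Max_ge[OF fin, of w] by (force simp: moved_def y_def)
  \<comment> \<open>Taking the least point of the fibre keeps \<beta> order-decreasing: every x in
    the fibre satisfies m \<le> x.\<close>
  define m where "m = (LEAST x. \<alpha> x = Some y)"
  have m: "\<alpha> m = Some y" using y(1) unfolding m_def ran_def by (auto intro: LeastI)
  have m_le: "m \<le> x" if "\<alpha> x = Some y" for x unfolding m_def using that by (rule Least_le)
  have "m \<noteq> y" using m y(2) by auto
  then have ym: "y < m" using LS_bounds[OF L m] by simp
  \<comment> \<open>An image point above y is fixed, but m > y is sent to y.\<close>
  have m_ran: "m \<notin> ran \<alpha>" using above[of m] ym m by auto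
  have mn: "m \<le> n" "1 \<le> y" using LS_bounds[OF L m] by auto
  define \<beta> where "\<beta> = (\<lambda>x. if \<alpha> x = Some y then Some m else \<alpha> x)"
  \<comment> \<open>\<gamma> is the identity on \<open>ran \<alpha>\<close>, extended by sending the
    new point m to y; this undoes the shift made by \<beta> without enlarging the image.\<close>
  define \<gamma> where "\<gamma> = (\<lambda>x. if x = m then Some y else if x \<in> ran \<alpha> then Some x else None)"
  \<comment> \<open>No image point lies in the interval (y, m]: such a w would be fixed by \<alpha>,
    and w \<le> m would force w \<le> y by isotonicity. This gap makes both \<beta> and \<gamma>
    isotone.\<close>
  have above_m: "m < w" if "\<alpha> x = Some w" "y < w" for x w
  proof (rule ccontr)
    assume "\<not> m < w"
    moreover have "\<alpha> w = Some w" using that by (intro above) (auto simp: ran_def)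
    ultimately show False using LS_mono[OF L _ m, of w w] that by simp
  qed
  have ran_b: "ran \<beta> = insert m (ran \<alpha> - {y})"
  proof (intro equalityI subsetI)
    fix z assume "z \<in> ran \<beta>"
    then show "z \<in> insert m (ran \<alpha> - {y})" by (auto simp: ran_def \<beta>_def split: if_splits)
  next
    fix z assume "z \<in> insert m (ran \<alpha> - {y})"
    then consider "z = m" | x where "\<alpha> x = Some z" "z \<noteq> y" by (auto simp: ran_def)
    then show "z \<in> ran \<beta>"
    proof cases
      case 1
      have "\<beta> m = Some m" using m by (simp add: \<beta>_def)
      then show ?thesis unfolding 1 by (rule ranI)
    next
      case 2
      then have "\<beta> x = Some z" by (simp add: \<beta>_def)
      then show ?thesis by (rule ranI)
    qed
  qed
  have "\<beta> \<in> LS n"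
    unfolding LS_iff
  proof (intro conjI allI impI)
    fix x z assume bx: "\<beta> x = Some z"
    have "1 \<le> z \<and> z \<le> x \<and> x \<le> n"
    proof (cases "\<alpha> x = Some y")
      case True
      then have "z = m" using bx by (simp add: \<beta>_def)
      then show ?thesis using m_le[OF True] LS_bounds[OF L True] ym by linarith
    next
      case False
      then have "\<alpha> x = Some z" using bx by (simp add: \<beta>_def)
      then show ?thesis by (rule LS_bounds[OF L])
    qed
    then show "1 \<le> z" "z \<le> x" "x \<le> n" by simp_all
  next
    fix x x' z z' assume b: "\<beta> x = Some z" "\<beta> x' = Some z'" "x \<le> x'"
    then obtain w w' where w: "\<alpha> x = Some w" "\<alpha> x' = Some w'"
      by (auto simp: \<beta>_def split: if_splits)
    have "w \<le> w'" using LS_mono[OF L w b(3)] .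
    then show "z \<le> z'"
      using b w ym above_m[OF w(2)] by (auto simp: \<beta>_def split: if_splits)
  qed
  \<comment> \<open>The image merely exchanges y for m.\<close>
  moreover have "card (ran \<beta>) = p"
    unfolding ran_b using m_ran finr y(1) cp p by (simp add: card_Diff_singleton)
  ultimately have b_in: "\<beta> \<in> LSr n p" by (simp add: LSr_def)
  have ran_g: "ran \<gamma> = ran \<alpha>"
  proof (intro equalityI subsetI)
    fix z assume "z \<in> ran \<gamma>"
    then obtain x where "\<gamma> x = Some z" by (auto simp: ran_def)
    then show "z \<in> ran \<alpha>" using y(1) by (auto simp: \<gamma>_def split: if_splits)
  next
    fix z assume "z \<in> ran \<alpha>"
    then have "\<gamma> z = Some z" using m_ran by (auto simp: \<gamma>_def)
    then show "z \<in> ran \<gamma>" by (rule ranI)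
  qed
  have ran_bd: "1 \<le> z \<and> z \<le> n" if "z \<in> ran \<alpha>" for z
    using L that by (auto simp: LS_def)
  have below_m: "w \<le> y" if "w \<in> ran \<alpha>" "w \<le> m" for w
  proof (rule ccontr)
    assume "\<not> w \<le> y"
    then show False using above_m[of _ w] that by (auto simp: ran_def)
  qed
  have "\<gamma> \<in> LS n"
    unfolding LS_iff
  proof (intro conjI allI impI)
    fix x z assume "\<gamma> x = Some z"
    then have "1 \<le> z \<and> z \<le> x \<and> x \<le> n"
      using ran_bd[of x] mn ym by (auto simp: \<gamma>_def split: if_splits)
    then show "1 \<le> z" "z \<le> x" "x \<le> n" by auto
  next
    fix x x' z z' assume "\<gamma> x = Some z" "\<gamma> x' = Some z'" "x \<le> x'"
    then show "z \<le> z'"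
      using ym below_m[of x] by (auto simp: \<gamma>_def split: if_splits)
  qed
  moreover have "\<gamma> z = Some z" if "z \<in> ran \<alpha>" for z using that m_ran by (auto simp: \<gamma>_def)
  ultimately have g_in: "\<gamma> \<in> ELS n p" by (simp add: ELS_def LSr_def ran_g cp)
  have comp: "comp_right \<beta> \<gamma> = \<alpha>"
  proof
    fix x
    show "comp_right \<beta> \<gamma> x = \<alpha> x"
    proof (cases "\<alpha> x")
      case (Some w)
      then have "w \<in> ran \<alpha>" by (rule ranI)
      then have "\<exists>v. \<beta> x = Some v \<and> \<gamma> v = Some w"
        using Some m_ran by (cases "w = y") (auto simp: \<beta>_def \<gamma>_def)
      then show ?thesis using Some by (simp add: comp_right_Some)
    qed (simp add: comp_right_def \<beta>_def)
  qed
  \<comment> \<open>The new image point m lies in the shifted fibre and is fixed by \<beta>, the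
    point y has left the image, and at any other image point \<beta> fixes whatever \<alpha>
    fixes.\<close>
  have "moved \<beta> \<subseteq> moved \<alpha> - {y}"
  proof
    fix w assume "w \<in> moved \<beta>"
    then have w: "w \<in> insert m (ran \<alpha> - {y})" "\<beta> w \<noteq> Some w"
      unfolding moved_def ran_b by blast+
    have "w \<noteq> m" using w(2) m by (auto simp: \<beta>_def)
    then have wr: "w \<in> ran \<alpha>" "w \<noteq> y" using w(1) by blast+
    then have "\<alpha> w \<noteq> Some w" using w(2) by (auto simp: \<beta>_def)
    then show "w \<in> moved \<alpha> - {y}" using wr by (simp add: moved_def)
  qed
  then have "moved \<beta> \<subset> moved \<alpha>" using y_mem by blast
  then have "card (moved \<beta>) < card (moved \<alpha>)" using fin by (rule psubset_card_mono[rotated])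
  with b_in g_in comp show ?thesis by (rule that)
qed

lemma nonzero_in_gen_idempotents:
  "\<alpha> \<in> LSr n p \<Longrightarrow> Some \<alpha> \<in> gen (RLS_mult n p) (Some ` ELS n p)"
proof (induction "card (moved \<alpha>)" arbitrary: \<alpha> rule: less_induct)
  case less
  show ?case
  proof (cases "\<alpha> \<in> ELS n p")
    case True
    then show ?thesis by (auto intro: gen.incl)
  next
    case False
    with less.prems obtain \<beta> \<gamma> where bg: "\<beta> \<in> LSr n p" "\<gamma> \<in> ELS n p" "comp_right \<beta> \<gamma> = \<alpha>"
      "card (moved \<beta>) < card (moved \<alpha>)"
      by (rule factor_non_idempotent)
    have "RLS_mult n p (Some \<beta>) (Some \<gamma>) \<in> gen (RLS_mult n p) (Some ` ELS n p)"
    proof (rule gen.mult)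
      show "Some \<beta> \<in> gen (RLS_mult n p) (Some ` ELS n p)" using bg(4,1) by (rule less.hyps)
      show "Some \<gamma> \<in> gen (RLS_mult n p) (Some ` ELS n p)" using bg(2) by (auto intro: gen.incl)
    qed
    moreover have "RLS_mult n p (Some \<beta>) (Some \<gamma>) = Some \<alpha>"
      using bg less.prems by (simp add: RLS_mult_Some ELS_def)
    ultimately show ?thesis by simp
  qed
qed

section \<open>The zero as a product of idempotents\<close>

definition partial_id :: "nat set \<Rightarrow> (nat \<rightharpoonup> nat)" where
  "partial_id X = (\<lambda>x. if x \<in> X then Some x else None)"

lemma partial_id_Some: "partial_id X x = Some y \<longleftrightarrow> x \<in> X \<and> y = x"
  by (auto simp: partial_id_def)

lemma ran_partial_id: "ran (partial_id X) = X"
  by (auto simp: ran_def partial_id_Some)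

lemma partial_id_ELS: "X \<subseteq> {1..n} \<Longrightarrow> card X = p \<Longrightarrow> partial_id X \<in> ELS n p"
  by (auto simp: ELS_def LSr_def LS_iff ran_partial_id partial_id_Some)

lemma zero_in_gen_idempotents:
  assumes "p < n"
  shows "None \<in> gen (RLS_mult n p) (Some ` ELS n p)"
proof -
  \<comment> \<open>Two p-subsets of [n] with only p - 1 common points. The second contains p + 1,
    and p < n leaves room for it.\<close>
  let ?e = "partial_id {1..p}" and ?f = "partial_id {2..p + 1}"
  have ef: "?e \<in> ELS n p" "?f \<in> ELS n p" using assms by (auto intro!: partial_id_ELS)
  have "ran (comp_right ?e ?f) \<subseteq> {2..p}"
    by (auto simp: ran_def comp_right_Some partial_id_Some)
  then have "card (ran (comp_right ?e ?f)) \<le> card {2..p}" by (intro card_mono) auto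
  also have "\<dots> < p" using p by simp
  finally have "comp_right ?e ?f \<notin> LSr n p" by (simp add: LSr_def)
  then have "RLS_mult n p (Some ?e) (Some ?f) = None"
    using ef by (simp add: RLS_mult_Some ELS_def)
  moreover have "RLS_mult n p (Some ?e) (Some ?f) \<in> gen (RLS_mult n p) (Some ` ELS n p)"
    using ef by (intro gen.mult gen.incl) auto
  ultimately show ?thesis by simp
qed

text \<open>Covers p = n too, where the identity is the only nonzero element and generates only
  itself, so the zero has to be adjoined.\<close>

lemma idempotents_generate_with_zero:
  "insert None (gen (RLS_mult n p) (Some ` ELS n p)) = RLS n p"
proof -
  have "gen (RLS_mult n p) (Some ` ELS n p) \<subseteq> RLS n p"
    by (rule gen_subset_RLS) (auto simp: RLS_eq ELS_def)
  then show ?thesis using nonzero_in_gen_idempotents by (auto simp: RLS_eq)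
qed

lemma idempotents_generate:
  assumes "p < n"
  shows "gen (RLS_mult n p) (Some ` ELS n p) = RLS n p"
  using idempotents_generate_with_zero by (simp add: insert_absorb zero_in_gen_idempotents[OF assms])

section \<open>Counting the idempotents\<close>

text \<open>Order-decrease gives y \<le> x; an image point m \<le> x is fixed, so isotonicity gives
  m \<le> y. Hence domain and image determine an idempotent.\<close>

lemma ELS_value:
  assumes e: "\<epsilon> \<in> ELS n p" and x: "\<epsilon> x = Some y"
  shows "y = Max {m \<in> ran \<epsilon>. m \<le> x}"
proof (rule Max_eqI[symmetric])
  have L: "\<epsilon> \<in> LS n" and fix_ran: "\<And>m. m \<in> ran \<epsilon> \<Longrightarrow> \<epsilon> m = Some m"
    using e by (auto simp: ELS_def LSr_def)
  show "finite {m \<in> ran \<epsilon>. m \<le> x}" by simp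
  show "y \<in> {m \<in> ran \<epsilon>. m \<le> x}" using LS_bounds[OF L x] x by (auto intro: ranI)
  show "m \<le> y" if "m \<in> {m \<in> ran \<epsilon>. m \<le> x}" for m
    using that LS_mono[OF L fix_ran[of m] x] by simp
qed

lemma inj_dom_ran_ELS: "inj_on (\<lambda>\<epsilon>. (dom \<epsilon>, ran \<epsilon>)) (ELS n p)"
proof (rule inj_onI)
  fix \<epsilon> \<delta> assume ed: "\<epsilon> \<in> ELS n p" "\<delta> \<in> ELS n p" "(dom \<epsilon>, ran \<epsilon>) = (dom \<delta>, ran \<delta>)"
  show "\<epsilon> = \<delta>"
  proof
    fix x
    show "\<epsilon> x = \<delta> x"
    proof (cases "x \<in> dom \<epsilon>")
      case True
      then obtain y z where "\<epsilon> x = Some y" "\<delta> x = Some z" using ed(3) by blast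
      then show ?thesis using ed ELS_value[of \<epsilon> x y] ELS_value[of \<delta> x z] by simp
    next
      case False
      then show ?thesis using ed(3) by (metis domIff prod.inject)
    qed
  qed
qed

text \<open>The possible images of an idempotent with domain D. For empty D the unspecified value of
  \<open>Min\<close> does no harm: M would be empty, contrary to \<open>card M = p\<close> with 1
  \<le> p.\<close>

definition marked_subsets :: "nat set \<Rightarrow> nat set set" where
  "marked_subsets D = {M. M \<subseteq> D \<and> card M = p \<and> Min D \<in> M}"

lemma dom_ran_ELS:
  "(\<lambda>\<epsilon>. (dom \<epsilon>, ran \<epsilon>)) ` ELS n p = (SIGMA D:Pow {1..n}. marked_subsets D)"
proof (intro equalityI subsetI)
  fix z assume "z \<in> (\<lambda>\<epsilon>. (dom \<epsilon>, ran \<epsilon>)) ` ELS n p"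
  then obtain \<epsilon> where e: "\<epsilon> \<in> ELS n p" and z: "z = (dom \<epsilon>, ran \<epsilon>)" by blast
  have L: "\<epsilon> \<in> LS n" and fix_ran: "\<And>m. m \<in> ran \<epsilon> \<Longrightarrow> \<epsilon> m = Some m" and c: "card (ran \<epsilon>) = p"
    using e by (auto simp: ELS_def LSr_def)
  have "ran \<epsilon> \<noteq> {}" using c p by auto
  then have ne: "dom \<epsilon> \<noteq> {}" by (auto simp: ran_def)
  have sub: "ran \<epsilon> \<subseteq> dom \<epsilon>" using fix_ran by blast
  obtain y where y: "\<epsilon> (Min (dom \<epsilon>)) = Some y"
    using Min_in[OF finite_dom_LS[OF L] ne] by blast
  then have yr: "y \<in> ran \<epsilon>" by (rule ranI)
  \<comment> \<open>The image lies in the domain, so y cannot be below the minimum; order-decrease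
    excludes that it is above. So the minimum of the domain is an image point.\<close>
  then have "Min (dom \<epsilon>) \<le> y" using sub finite_dom_LS[OF L] by (intro Min_le) auto
  then have "Min (dom \<epsilon>) = y" using LS_bounds[OF L y] by simp
  then show "z \<in> (SIGMA D:Pow {1..n}. marked_subsets D)"
    using L sub c yr z by (simp add: marked_subsets_def LS_def)
next
  fix z assume "z \<in> (SIGMA D:Pow {1..n}. marked_subsets D)"
  then obtain D M where z: "z = (D, M)" and D: "D \<subseteq> {1..n}"
    and M: "M \<subseteq> D" "card M = p" "Min D \<in> M"
    by (auto simp: marked_subsets_def)
  have finD: "finite D" using D by (rule finite_subset) simp
  define f where "f x = Max {m \<in> M. m \<le> x}" for x
  define \<epsilon> where "\<epsilon> = (\<lambda>x. if x \<in> D then Some (f x) else None)"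
  have f: "f x \<in> M" "f x \<le> x" "\<And>m. m \<in> M \<Longrightarrow> m \<le> x \<Longrightarrow> m \<le> f x" if "x \<in> D" for x
  proof -
    have "Min D \<in> {m \<in> M. m \<le> x}" using M(3) finD that by simp
    then have "Max {m \<in> M. m \<le> x} \<in> {m \<in> M. m \<le> x}" by (intro Max_in) auto
    then show "f x \<in> M" "f x \<le> x" by (auto simp: f_def)
    show "m \<le> f x" if "m \<in> M" "m \<le> x" for m
      using that by (auto simp: f_def intro!: Max_ge)
  qed
  have f_fix: "f m = m" if "m \<in> M" for m
    using f[of m] that M(1) by (meson order.refl order.antisym subsetD)
  have e_Some: "\<epsilon> x = Some y \<longleftrightarrow> x \<in> D \<and> y = f x" for x y by (auto simp: \<epsilon>_def)
  have dom_e: "dom \<epsilon> = D" by (auto simp: e_Some dom_def)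
  have ran_e: "ran \<epsilon> = M"
  proof (intro equalityI subsetI)
    fix y assume "y \<in> ran \<epsilon>" then show "y \<in> M" using f(1) by (auto simp: ran_def e_Some)
  next
    fix y assume "y \<in> M"
    then have "\<epsilon> y = Some y" using M(1) f_fix by (auto simp: e_Some)
    then show "y \<in> ran \<epsilon>" by (rule ranI)
  qed
  have "\<epsilon> \<in> LS n"
    unfolding LS_iff e_Some
  proof (intro conjI allI impI; elim conjE)
    fix x y assume "x \<in> D" "y = f x"
    moreover from this have "y \<in> D" using f(1) M(1) by blast
    ultimately show "1 \<le> y" "y \<le> x" "x \<le> n" using D f(2) by auto
  next
    fix x x' y y' assume "x \<in> D" "y = f x" "x' \<in> D" "y' = f x'" "x \<le> x'"
    then show "y \<le> y'" using f(1,2)[of x] f(3)[of x'] by simp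
  qed
  then have "\<epsilon> \<in> ELS n p"
    using M f_fix by (auto simp: ELS_def LSr_def ran_e e_Some)
  then show "z \<in> (\<lambda>\<epsilon>. (dom \<epsilon>, ran \<epsilon>)) ` ELS n p" using z dom_e ran_e by force
qed

text \<open>Deleting \<open>Min D\<close> is a bijection onto the (p - 1)-subsets of the remaining
  points. The guard matters at D empty and p = 1, where truncated subtraction would give 0 choose 0
  = 1 although no marked subset exists.\<close>

lemma card_marked_subsets:
  assumes "finite D"
  shows "card (marked_subsets D) =
    (if p \<le> card D then (card D - 1) choose (p - 1) else 0)"
proof (cases "p \<le> card D")
  case True
  let ?m = "Min D" and ?T = "{N. N \<subseteq> D - {Min D} \<and> card N = p - 1}"
  have mD: "?m \<in> D" using True p assms by (intro Min_in) auto
  have fin: "finite N" if "N \<subseteq> D" for N using that assms by (rule finite_subset)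
  have "marked_subsets D = insert ?m ` ?T"
  proof (intro equalityI subsetI)
    fix M assume M: "M \<in> marked_subsets D"
    then have "M - {?m} \<in> ?T" "M = insert ?m (M - {?m})"
      using fin by (auto simp: marked_subsets_def card_Diff_singleton)
    then show "M \<in> insert ?m ` ?T" by blast
  next
    fix M assume "M \<in> insert ?m ` ?T"
    then obtain N where N: "N \<subseteq> D - {?m}" "card N = p - 1" "M = insert ?m N" by blast
    moreover have "finite N" "?m \<notin> N" using N(1) fin by blast+
    ultimately show "M \<in> marked_subsets D"
      using mD p by (auto simp: marked_subsets_def)
  qed
  moreover have "inj_on (insert ?m) ?T"
  proof (rule inj_onI)
    fix N N' assume "N \<in> ?T" "N' \<in> ?T" "insert ?m N = insert ?m N'"
    then show "N = N'" by blast
  qed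
  ultimately have "card (marked_subsets D) = card ?T" by (simp add: card_image)
  also have "\<dots> = (card D - 1) choose (p - 1)"
    using assms mD by (simp add: n_subsets card_Diff_singleton)
  finally show ?thesis using True by simp
next
  case False
  then have "marked_subsets D = {}"
    using card_mono[OF assms] by (auto simp: marked_subsets_def)
  then show ?thesis using False by simp
qed

lemma card_ELS: "card (ELS n p) = (\<Sum>r = p..n. (n choose r) * ((r - 1) choose (p - 1)))"
proof -
  let ?g = "\<lambda>r. if p \<le> r then (r - 1) choose (p - 1) else 0"
  have fin: "finite D" if "D \<in> Pow {1..n}" for D
    using that by (auto intro: finite_subset)
  have "card (ELS n p) = card ((\<lambda>\<epsilon>. (dom \<epsilon>, ran \<epsilon>)) ` ELS n p)"
    using inj_dom_ran_ELS by (simp add: card_image)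
  also have "\<dots> = (\<Sum>D\<in>Pow {1..n}. card (marked_subsets D))"
    unfolding dom_ran_ELS
  proof (rule card_SigmaI)
    show "\<forall>D\<in>Pow {1..n}. finite (marked_subsets D)"
      using fin by (auto simp: marked_subsets_def)
  qed simp
  also have "\<dots> = (\<Sum>D\<in>Pow {1..n}. ?g (card D))"
    using fin by (intro sum.cong) (simp_all add: card_marked_subsets)
  \<comment> \<open>The summand depends on D only through its size, so the domains are grouped by
    cardinality r.\<close>
  also have "\<dots> = (\<Sum>r\<in>{0..n}. \<Sum>D\<in>{D \<in> Pow {1..n}. card D = r}. ?g (card D))"
    using card_mono[of "{1..n}"] by (intro sum.group[symmetric]) auto
  also have "\<dots> = (\<Sum>r\<in>{0..n}. (n choose r) * ?g r)"
    using n_subsets[of "{1..n}"] by (intro sum.cong) simp_all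
  also have "\<dots> = (\<Sum>r = p..n. (n choose r) * ((r - 1) choose (p - 1)))"
    by (rule sum.mono_neutral_cong_right) auto
  finally show ?thesis .
qed

end

section \<open>Computation of the ranks\<close>

text \<open>Common shape of the four rank definitions: P says which sets are admissible as
  generators, Q that they generate, and E is an optimal choice.\<close>

lemma Least_card_eq:
  assumes "P E" "finite E" "Q E" and "\<And>A. P A \<Longrightarrow> finite A \<Longrightarrow> Q A \<Longrightarrow> card E \<le> card A"
  shows "(LEAST k. \<exists>A. P A \<and> finite A \<and> card A = k \<and> Q A) = card E"
  by (rule Least_equality) (use assms in blast)+

text \<open>The plain ranks are restricted to p < n because at p = n the zero is not a product of
  nonzero elements and would have to be an extra generator.\<close>

theorem theorem3p5:
  fixes n p :: nat
  assumes "1 \<le> p" and "p \<le> n"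
  shows "(p < n \<longrightarrow>
            rank (RLS_mult n p) (RLS n p)
              = card (idempotents (RLS_mult n p) (RLS n p) - {None}) \<and>
            idrank (RLS_mult n p) (RLS n p)
              = card (idempotents (RLS_mult n p) (RLS n p) - {None})) \<and>
         rank0 (RLS_mult n p) None (RLS n p)
           = card (idempotents (RLS_mult n p) (RLS n p) - {None}) \<and>
         idrank0 (RLS_mult n p) None (RLS n p)
           = card (idempotents (RLS_mult n p) (RLS n p) - {None}) \<and>
         card (idempotents (RLS_mult n p) (RLS n p) - {None})
           = (\<Sum>r = p..n. (n choose r) * ((r - 1) choose (p - 1)))"
proof -
  let ?mul = "RLS_mult n p" and ?E = "Some ` ELS n p"
  have id_sub: "idempotents ?mul (RLS n p) \<subseteq> RLS n p" by (auto simp: idempotents_def)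
  have E_id: "?E \<subseteq> idempotents ?mul (RLS n p)"
    unfolding idempotents_RLS[OF assms(1)] by blast
  then have E: "?E \<subseteq> RLS n p" "?E \<subseteq> idempotents ?mul (RLS n p)" "finite ?E"
    using id_sub by (auto simp: finite_ELS)
  \<comment> \<open>The members of \<open>?E\<close> differ from \<open>None\<close>, so they must
    be generated even when the zero is supplied for free.\<close>
  have ge0: "card ?E \<le> card A"
    if "A \<subseteq> RLS n p" "finite A" "insert None (gen ?mul A) = RLS n p" for A
    using that(1,2) by (rule generators_ge[OF assms(1)]) (use that(3) E(1) in blast)
  have ge: "card ?E \<le> card A"
    if "A \<subseteq> RLS n p" "finite A" "gen ?mul A = RLS n p" for A
    using that(1,2) by (rule generators_ge[OF assms(1)]) (use that(3) E(1) in blast)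
  have "rank ?mul (RLS n p) = card ?E" if "p < n"
    unfolding rank_def
    using E(1,3) idempotents_generate[OF assms(1) that] by (rule Least_card_eq) (rule ge)
  moreover have "idrank ?mul (RLS n p) = card ?E" if "p < n"
    unfolding idrank_def
    using E(2,3) idempotents_generate[OF assms(1) that]
    by (rule Least_card_eq) (rule ge[OF subset_trans[OF _ id_sub]])
  moreover have "rank0 ?mul None (RLS n p) = card ?E"
    unfolding rank0_def
    using E(1,3) idempotents_generate_with_zero[OF assms(1)] by (rule Least_card_eq) (rule ge0)
  moreover have "idrank0 ?mul None (RLS n p) = card ?E"
    unfolding idrank0_def
    using E(2,3) idempotents_generate_with_zero[OF assms(1)]
    by (rule Least_card_eq) (rule ge0[OF subset_trans[OF _ id_sub]])
  moreover have "card ?E = (\<Sum>r = p..n. (n choose r) * ((r - 1) choose (p - 1)))"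
    using card_ELS[OF assms(1)] by (simp add: card_image)
  ultimately show ?thesis
    unfolding nonzero_idempotents_RLS[OF assms(1)] by simp
qed

end
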